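(* Let $\alpha,\beta,\gamma,\delta,\omega_1,\omega_2\in\mathbb{C}$ with $\mathrm{Re}(\alpha),\mathrm{Re}(\beta),\mathrm{Re}(\gamma)>0$, and let $c\in\mathbb{R}$. Then for all $\mu\in\mathbb{C}$ and all $t>c$, $${}^{RL}_{\ \,c}D_t^{\mu}\left[(t-c)^{\gamma-1}E_{\alpha,\beta,\gamma}^{\delta}\left(\omega_1(t-c)^{\alpha},\omega_2(t-c)^{\beta}\right)\right]=(t-c)^{\gamma-\mu-1}E_{\alpha,\beta,\gamma-\mu}^{\delta}\left(\omega_1(t-c)^{\alpha},\omega_2(t-c)^{\beta}\right)$$ (a fractional integral if $\mathrm{Re}(\mu)<0$, a fractional derivative if $\mathrm{Re}(\mu)\geq0$).
   Context: For $\alpha,\beta,\gamma,\delta\in\mathbb{C}$ with $\mathrm{Re}(\alpha)>0$, $\mathrm{Re}(\beta)>0$ and $x,y\in\mathbb{C}$, the bivariate Mittag-Leffler function is $$E_{\alpha,\beta,\gamma}^{\delta}(x,y)=\sum_{k=0}^{\infty}\sum_{l=0}^{\infty}\frac{(\delta)_{k+l}}{\Gamma(\alpha k+\beta l+\gamma)}\cdot\frac{x^ky^l}{k!\,l!}$$ (the double series converges absolutely), where $(a)_n=a(a+1)\cdots(a+n-1)$, $(a)_0=1$, is the Pochhammer symbol, and $1/\Gamma$ is taken to be $0$ at the poles of $\Gamma$. Complex powers of positive reals are principal. Riemann--Liouville operators: for $\mathrm{Re}(\nu)>0$, ${}^{RL}_{\ \,c}I_{t}^{\nu}f(t)=\frac{1}{\Gamma(\nu)}\int_c^t(t-\xi)^{\nu-1}f(\xi)\,\mathrm{d}\xi$;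 for $\mathrm{Re}(\nu)\geq0$, ${}^{RL}_{\ \,c}D_{t}^{\nu}f(t)=\frac{\mathrm{d}^m}{\mathrm{d}t^m}\,{}^{RL}_{\ \,c}I_{t}^{m-\nu}f(t)$ with $m=\lfloor\mathrm{Re}(\nu)\rfloor+1$; and for $\mathrm{Re}(\mu)<0$, ${}^{RL}_{\ \,c}D_t^{\mu}:={}^{RL}_{\ \,c}I_t^{-\mu}$. *)

theory Defs
  imports "HOL-Analysis.Analysis"
begin

(* rGamma is the entire function 1/Gamma, so it vanishes at the poles of Gamma. *)
definition bivariate_ML ::
  "complex \<Rightarrow> complex \<Rightarrow> complex \<Rightarrow> complex \<Rightarrow> complex \<Rightarrow> complex \<Rightarrow> complex" where
  "bivariate_ML \<alpha> \<beta> \<gamma> \<delta> x y =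
     (\<Sum>k. \<Sum>l. pochhammer \<delta> (k + l) * rGamma (\<alpha> * of_nat k + \<beta> * of_nat l + \<gamma>)
                * (x ^ k * y ^ l / (fact k * fact l)))"

(* Meant for Re \<nu> > 0 and t > c. *)
definition RL_integrable :: "real \<Rightarrow> complex \<Rightarrow> (real \<Rightarrow> complex) \<Rightarrow> real \<Rightarrow> bool" where
  "RL_integrable c \<nu> f t \<longleftrightarrow>
     interval_lebesgue_integrable lborel (ereal c) (ereal t)
       (\<lambda>\<xi>. of_real (t - \<xi>) powr (\<nu> - 1) * f \<xi>)"

definition RL_integral :: "real \<Rightarrow> complex \<Rightarrow> (real \<Rightarrow> complex) \<Rightarrow> real \<Rightarrow> complex" where
  "RL_integral c \<nu> f t =
     1 / Gamma \<nu> * (LBINT \<xi>=ereal c..ereal t. of_real (t - \<xi>) powr (\<nu> - 1) * f \<xi>)"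

definition nth_deriv :: "nat \<Rightarrow> (real \<Rightarrow> complex) \<Rightarrow> real \<Rightarrow> complex" where
  "nth_deriv m = (\<lambda>g s. vector_derivative g (at s)) ^^ m"

definition RL_order :: "complex \<Rightarrow> nat" where
  "RL_order \<mu> = nat (\<lfloor>Re \<mu>\<rfloor> + 1)"

definition RL_D :: "real \<Rightarrow> complex \<Rightarrow> (real \<Rightarrow> complex) \<Rightarrow> real \<Rightarrow> complex" where
  "RL_D c \<mu> f t =
     (if Re \<mu> < 0 then RL_integral c (- \<mu>) f t
      else nth_deriv (RL_order \<mu>) (RL_integral c (of_nat (RL_order \<mu>) - \<mu>) f) t)"

(* Integrals and derivatives are total functions in HOL; this predicate says that those
   occurring in RL_D c \<mu> f t exist, so that its value is not an arbitrary default. *)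
definition RL_D_exists :: "real \<Rightarrow> complex \<Rightarrow> (real \<Rightarrow> complex) \<Rightarrow> real \<Rightarrow> bool" where
  "RL_D_exists c \<mu> f t \<longleftrightarrow>
     (if Re \<mu> < 0 then RL_integrable c (- \<mu>) f t
      else
        (\<forall>\<^sub>F s in nhds t. RL_integrable c (of_nat (RL_order \<mu>) - \<mu>) f s) \<and>
        (\<forall>k < RL_order \<mu>. \<forall>\<^sub>F s in nhds t.
           nth_deriv k (RL_integral c (of_nat (RL_order \<mu>) - \<mu>) f) differentiable (at s)))"

end

theory Submission
  imports Defs
begin

text \<open>
  Multiplied out, \<open>u powr (\<gamma> - 1) * E (\<omega>\<^sub>1 * u powr \<alpha>, \<omega>\<^sub>2 * u powr \<beta>)\<close> with \<open>u = t - c\<close> is a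
  double series of the normalised powers \<open>u powr (w - 1) / \<Gamma>(w)\<close>, where \<open>w = \<alpha> k + \<beta> l + \<gamma>\<close>, with
  coefficients independent of \<open>\<gamma>\<close>. On a normalised power the operators act by shifting \<open>w\<close>:
  fractional integration of order \<open>\<nu>\<close> replaces \<open>w\<close> by \<open>w + \<nu>\<close>, which is Euler's Beta integral
  (\<open>truncated_power_convolution\<close>), and differentiation replaces \<open>w\<close> by \<open>w - 1\<close>, which is the
  functional equation of \<open>\<Gamma>\<close>. Hence on the series they shift \<open>\<gamma>\<close>, provided that they may be
  applied term by term (\<open>has_bochner_integral_mittag_leffler_kernel_convolution\<close>,
  \<open>has_vector_derivative_mittag_leffler_kernel\<close>). A fractional derivative of order \<open>\<mu>\<close> is an
  integral of order \<open>m - \<mu>\<close> followed by \<open>m\<close> derivatives, so \<open>\<gamma>\<close> becomes \<open>\<gamma> + (m - \<mu>) - m = \<gamma> - \<mu>\<close>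
  (\<open>RL_D_mittag_leffler_kernel\<close>).

  The analytic input is a bound on \<open>1 / \<Gamma>\<close> along the lattice of the \<open>w\<close>, which has to be valid for
  complex \<open>\<alpha>\<close> and \<open>\<beta>\<close>, where \<open>w\<close> runs off inside a sector. Stirling's formula can be avoided: the
  reflection formula bounds \<open>1 / \<Gamma>\<close> by a multiple of \<open>exp (\<pi> \<bar>Im z\<bar>)\<close> in a vertical strip of width
  one (\<open>norm_rGamma_strip_bound\<close>), and moving from the strip to the right by the functional
  equation gains a factorial (\<open>norm_rGamma_le\<close>). Inside a sector this decays faster than any
  geometric rate (\<open>rGamma_lattice_decay\<close>), so on bounded intervals the series has a geometric
  majorant times the leading power (\<open>norm_kernel_term_le\<close>), which justifies both exchanges.
\<close>

section \<open>Growth of the reciprocal Gamma function\<close>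

lemma Re_pos_not_nonpos_Ints: "Re z > 0 \<Longrightarrow> z \<notin> \<int>\<^sub>\<le>\<^sub>0"
  by (auto elim!: nonpos_Ints_cases)

lemma norm_Gamma_le_Gamma_Re:
  assumes "Re z > 0"
  shows "norm (Gamma z) \<le> Gamma (Re z)"
proof -
  note c = Gamma_integral_complex[OF assms] and r = Gamma_integral_real[OF assms]
  have "norm (integral {0..} (\<lambda>t. of_real t powr (z - 1) / of_real (exp t)))
      \<le> integral {0..} (\<lambda>t. t powr (Re z - 1) / exp t)"
    using c r by (intro integral_norm_bound_integral)
      (auto simp: norm_divide norm_powr_real_powr has_integral_integrable_integral)
  with c r show ?thesis by (simp add: integral_unique)
qed

text \<open>
  The reflection formula writes \<open>1 / \<Gamma>(w)\<close> as \<open>sin (\<pi> w) \<Gamma>(1 - w) / \<pi>\<close>. Moved two units to the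
  left, the strip lies where \<open>\<Gamma>(1 - w)\<close> is bounded, so only the exponential growth of the sine in
  the imaginary direction remains. Moving back divides by \<open>w (w + 1)\<close>, which is harmless away from
  the real axis; near the real axis compactness gives the bound.
\<close>
lemma norm_rGamma_strip_bound:
  obtains C where "C \<ge> 0"
    "\<And>z. 1 \<le> Re z \<Longrightarrow> Re z \<le> 2 \<Longrightarrow> norm (rGamma z) \<le> C * exp (pi * \<bar>Im z\<bar>)"
proof -
  define K where "K = {z::complex. 1 \<le> Re z \<and> Re z \<le> 2 \<and> -1 \<le> Im z \<and> Im z \<le> 1}"
  have "K = cbox (Complex 1 (-1)) (Complex 2 1)"
    by (auto simp: K_def in_cbox_complex_iff)
  hence "compact K" by simp
  hence "bounded (rGamma ` K)"
    by (intro compact_imp_bounded compact_continuous_image continuous_intros) auto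
  then obtain A where A: "\<And>z. z \<in> K \<Longrightarrow> norm (rGamma z) \<le> A" by (auto simp: bounded_iff)
  have "bounded (Gamma ` {1..2::real})"
    by (intro compact_imp_bounded compact_continuous_image continuous_intros) (auto elim!: nonpos_Ints_cases)
  then obtain B where B: "\<And>x. x \<in> {1..2} \<Longrightarrow> norm (Gamma x :: real) \<le> B"
    unfolding bounded_iff by blast
  define C where "C = max 0 (max A B)"
  have "norm (rGamma z) \<le> C * exp (pi * \<bar>Im z\<bar>)" if z: "1 \<le> Re z" "Re z \<le> 2" for z
  proof (cases "\<bar>Im z\<bar> \<le> 1")
    case True
    have "norm (rGamma z) \<le> C * 1" using A[of z] z True by (simp add: K_def C_def abs_le_iff le_max_iff_disj)
    also have "\<dots> \<le> C * exp (pi * \<bar>Im z\<bar>)" by (intro mult_left_mono) (auto simp: C_def)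
    finally show ?thesis .
  next
    case False
    define w where "w = z - 2"
    have w: "norm w \<ge> 1" "norm (w + 1) \<ge> 1"
      using False abs_Im_le_cmod[of w] abs_Im_le_cmod[of "w + 1"] by (auto simp: w_def)
    have "rGamma w = w * ((w + 1) * rGamma (w + 1 + 1))" by (simp only: rGamma_plus1)
    hence "rGamma w = w * (w + 1) * rGamma z" by (simp add: w_def mult.assoc)
    moreover have "1 * 1 * norm (rGamma z) \<le> norm w * norm (w + 1) * norm (rGamma z)"
      using w by (intro mult_right_mono mult_mono) auto
    ultimately have "norm (rGamma z) \<le> norm (rGamma w)" by (simp add: norm_mult)
    also have "rGamma w = sin (of_real pi * w) / of_real pi * Gamma (1 - w)"
    proof -
      have "1 - w \<notin> \<int>\<^sub>\<le>\<^sub>0" using z by (intro Re_pos_not_nonpos_Ints) (simp add: w_def)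
      hence "rGamma (1 - w) * Gamma (1 - w) = 1" by (simp add: rGamma_inverse_Gamma Gamma_eq_zero_iff)
      thus ?thesis using rGamma_reflection_complex[of w]
        by (metis mult.assoc mult.right_neutral)
    qed
    also have "norm \<dots> \<le> exp (pi * \<bar>Im z\<bar>) / 1 * B"
      unfolding norm_mult norm_divide
    proof (intro mult_mono frac_le)
      show "norm (sin (of_real pi * w)) \<le> exp (pi * \<bar>Im z\<bar>)"
        using cmod_sin_le_exp[of 1 "of_real pi * w"] by (simp add: w_def abs_mult)
      have "norm (Gamma (1 - w)) \<le> Gamma (Re (1 - w))"
        using z by (intro norm_Gamma_le_Gamma_Re) (simp add: w_def)
      also have "\<dots> \<le> B" using B[of "Re (1 - w)"] z by (simp add: w_def)
      finally show "norm (Gamma (1 - w)) \<le> B" .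
    qed (use pi_ge_two in auto)
    also have "\<dots> \<le> C * exp (pi * \<bar>Im z\<bar>)" by (simp add: C_def mult.commute)
    finally show ?thesis .
  qed
  moreover have "C \<ge> 0" by (simp add: C_def)
  ultimately show thesis using that by blast
qed

lemma norm_pochhammer_ge_fact:
  assumes "Re z \<ge> 1"
  shows "norm (pochhammer z n) \<ge> fact n"
proof -
  have "(\<Prod>i<n. real (Suc i)) \<le> (\<Prod>i<n. norm (z + of_nat i))"
  proof (intro prod_mono conjI)
    fix i show "real (Suc i) \<le> norm (z + of_nat i)"
      using complex_Re_le_cmod[of "z + of_nat i"] assms by simp
  qed simp
  thus ?thesis
    by (simp add: pochhammer_prod atLeast0LessThan prod_norm fact_prod_Suc)
qed

text \<open>
  To the right of the line \<open>Re z = 1\<close>, \<open>1 / \<Gamma>\<close> beats every exponential of the real part, at the price of a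
  fixed exponential of the imaginary part. The functional equation moves \<open>z\<close> into the strip
  \<open>1 \<le> Re \<le> 2\<close> and divides by a Pochhammer symbol at least as large as a factorial.
\<close>
lemma norm_rGamma_le:
  obtains C where "C \<ge> 0"
    "\<And>z. 1 \<le> Re z \<Longrightarrow> norm (rGamma z) \<le> C * exp (pi * \<bar>Im z\<bar> - M * Re z)"
proof -
  obtain A where A: "A \<ge> 0"
    "\<And>z. 1 \<le> Re z \<Longrightarrow> Re z \<le> 2 \<Longrightarrow> norm (rGamma z) \<le> A * exp (pi * \<bar>Im z\<bar>)"
    using norm_rGamma_strip_bound by blast
  define L where "L = max M 0"
  define C where "C = A * exp (exp L + 2 * L)"
  show thesis
  proof (rule that[of C])
    show "C \<ge> 0" using A(1) by (simp add: C_def)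
  next
    fix z :: complex assume z: "1 \<le> Re z"
    \<comment> \<open>This many unit steps to the left bring z into the strip 1 <= Re < 2.\<close>
    define n where "n = nat (\<lfloor>Re z\<rfloor> - 1)"
    define w where "w = z - of_nat n"
    have n: "Re z - 2 \<le> real n" "real n \<le> Re z - 1" using z unfolding n_def by linarith+
    have eq: "rGamma w = pochhammer w n * rGamma z"
      using pochhammer_rGamma[of w n] by (simp add: w_def)
    have "fact n * norm (rGamma z) \<le> norm (pochhammer w n) * norm (rGamma z)"
      by (intro mult_right_mono norm_pochhammer_ge_fact) (use n in \<open>auto simp: w_def\<close>)
    also have "\<dots> = norm (rGamma w)" by (simp add: eq norm_mult)
    also have "\<dots> \<le> A * exp (pi * \<bar>Im z\<bar>)" using A(2)[of w] n by (simp add: w_def)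
    finally have 1: "norm (rGamma z) \<le> A * exp (pi * \<bar>Im z\<bar>) / fact n" by (simp add: field_simps)
    have "exp L ^ n / fact n \<le> exp (exp L)"
    proof -
      have "(\<lambda>k. exp L ^ k / fact k) sums exp (exp L)"
        using exp_converges[of "exp L"] by (simp add: field_simps)
      thus ?thesis using sum_le_suminf[of "\<lambda>k. exp L ^ k / fact k" "{n}"] by (auto simp: sums_iff)
    qed
    hence "1 / fact n \<le> exp (exp L) / exp (L * n)"
      by (simp add: field_simps exp_of_nat_mult[symmetric])
    also have "\<dots> = exp (exp L - L * n)" by (simp add: exp_diff)
    also have "\<dots> \<le> exp (exp L + 2 * L - M * Re z)"
    proof -
      have "L * (Re z - 2) \<le> L * n" using n by (intro mult_left_mono) (auto simp: L_def)
      moreover have "M * Re z \<le> L * Re z" using z by (intro mult_right_mono) (auto simp: L_def)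
      ultimately show ?thesis by (simp add: algebra_simps)
    qed
    finally have 2: "1 / fact n \<le> exp (exp L + 2 * L - M * Re z)" .
    have "norm (rGamma z) \<le> A * exp (pi * \<bar>Im z\<bar>) * (1 / fact n)" using 1 by simp
    also have "\<dots> \<le> A * exp (pi * \<bar>Im z\<bar>) * exp (exp L + 2 * L - M * Re z)"
      by (intro mult_left_mono 2 mult_nonneg_nonneg A) auto
    also have "\<dots> = C * exp (pi * \<bar>Im z\<bar> - M * Re z)"
      by (simp add: C_def exp_add exp_diff field_simps)
    finally show "norm (rGamma z) \<le> C * exp (pi * \<bar>Im z\<bar> - M * Re z)" .
  qed
qed

section \<open>Truncated powers and the complex Beta integral\<close>

text \<open>
  The convolution kernel of fractional integration, extended by zero so that integrals over
  \<open>(0, u)\<close> become integrals over the whole line, where Fubini and affine substitutions apply without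
  boundary terms.
\<close>
definition truncated_power :: "complex \<Rightarrow> real \<Rightarrow> complex" where
  "truncated_power a x = (if x > 0 then of_real x powr (a - 1) else 0)"

lemma borel_measurable_truncated_power [measurable]:
  "truncated_power a \<in> borel_measurable borel"
proof -
  have "truncated_power a = (\<lambda>x. if x > 0 then exp ((a - 1) * of_real (ln x)) else 0)"
    by (auto simp: truncated_power_def powr_def Ln_of_real)
  thus ?thesis by simp
qed

lemma norm_truncated_power:
  "norm (truncated_power a x) = (if x > 0 then x powr (Re a - 1) else 0)"
  by (simp add: truncated_power_def norm_powr_real_powr)

lemma truncated_power_scale:
  assumes "u > 0"
  shows "truncated_power a (u * x) = of_real u powr (a - 1) * truncated_power a x"
  using assms by (simp add: truncated_power_def zero_less_mult_iff powr_times_real)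

lemma integrable_truncated_power_convolution:
  assumes "Re a > 0" "Re b > 0"
  shows "integrable lborel (\<lambda>x. truncated_power a x * truncated_power b (u - x))"
proof (cases "u > 0")
  case True
  have eq: "truncated_power b (u - u * x) = of_real u powr (b - 1) * truncated_power b (1 - x)" for x
    using truncated_power_scale[OF True, of b "1 - x"] by (simp add: algebra_simps)
  have "integrable lborel (\<lambda>x. truncated_power a x * truncated_power b (1 - x))"
  proof (rule Bochner_Integration.integrable_bound)
    show "integrable lborel (\<lambda>x. indicator {0..1} x *\<^sub>R (x powr (Re a - 1) * (1 - x) powr (Re b - 1)))"
      using integrable_Beta[OF assms] by (simp add: set_integrable_def)
  qed (auto intro!: AE_I2 simp: norm_mult norm_truncated_power)
  hence "integrable lborel (\<lambda>x. of_real u powr (a - 1) * of_real u powr (b - 1) *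
      (truncated_power a x * truncated_power b (1 - x)))" by simp
  also have "(\<lambda>x. of_real u powr (a - 1) * of_real u powr (b - 1) *
      (truncated_power a x * truncated_power b (1 - x))) =
      (\<lambda>x. truncated_power a (0 + u * x) * truncated_power b (u - (0 + u * x)))"
    by (simp add: truncated_power_scale[OF True] eq fun_eq_iff)
  finally show ?thesis
    using True by (subst (asm) lborel_integrable_real_affine_iff) auto
next
  case False
  hence "(\<lambda>x. truncated_power a x * truncated_power b (u - x)) = (\<lambda>_. 0)"
    by (auto simp: truncated_power_def)
  thus ?thesis by simp
qed

text \<open>
  Substituting \<open>u x\<close> for \<open>x\<close> pulls out all dependence on \<open>u\<close> as a power; what is left is a
  constant, identified with a Beta value below.
\<close>
lemma truncated_power_convolution_scale:
  "(\<integral>x. truncated_power a x * truncated_power b (u - x) \<partial>lborel) =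
     truncated_power (a + b) u * (\<integral>x. truncated_power a x * truncated_power b (1 - x) \<partial>lborel)"
proof (cases "u > 0")
  case True
  have eq: "truncated_power b (u - u * x) = of_real u powr (b - 1) * truncated_power b (1 - x)" for x
    using truncated_power_scale[OF True, of b "1 - x"] by (simp add: algebra_simps)
  have "of_real u powr (a + b - 1) = of_real u * (of_real u powr (a - 1) * of_real u powr (b - 1))"
    using True by (simp add: powr_diff powr_add)
  hence "\<bar>u\<bar> *\<^sub>R (truncated_power a (0 + u * x) * truncated_power b (u - (0 + u * x))) =
      truncated_power (a + b) u * (truncated_power a x * truncated_power b (1 - x))" for x
    using True
    by (simp add: truncated_power_scale[OF True] eq truncated_power_def[of "a + b"] scaleR_conv_of_real)
  thus ?thesis using True
    by (subst lborel_integral_real_affine[where c = u and t = 0]) (simp_all flip: integral_scaleR_right integral_mult_right_zero)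
next
  case False
  hence "(\<lambda>x. truncated_power a x * truncated_power b (u - x)) = (\<lambda>_. 0)"
    by (auto simp: truncated_power_def)
  with False show ?thesis by (simp add: truncated_power_def)
qed

lemma has_bochner_integral_Gamma:
  assumes "Re a > 0"
  shows "has_bochner_integral lborel (\<lambda>x. truncated_power a x * of_real (exp (-x))) (Gamma a)"
proof -
  let ?f = "\<lambda>t. complex_of_real t powr (a - 1) / of_real (exp t)"
  have eq: "(\<lambda>x. indicator {0<..} x *\<^sub>R ?f x) = (\<lambda>x. truncated_power a x * of_real (exp (-x)))"
    by (auto simp: truncated_power_def fun_eq_iff exp_minus field_simps indicator_def)
  note ai = absolutely_integrable_Gamma_integral'[OF assms]
  have "(LINT x:{0<..}|lebesgue. ?f x) = Gamma a"
    using set_lebesgue_integral_eq_integral(2)[OF ai] Gamma_integral_complex'[OF assms]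
    by (simp add: integral_unique)
  moreover have "(LINT x:{0<..}|lebesgue. ?f x) = (\<integral>x. truncated_power a x * of_real (exp (-x)) \<partial>lborel)"
    unfolding set_lebesgue_integral_def eq by (rule integral_completion) simp
  moreover have "integrable lborel (\<lambda>x. truncated_power a x * of_real (exp (-x)))"
    using ai unfolding set_integrable_def eq by (subst (asm) integrable_completion) simp_all
  ultimately show ?thesis by (simp add: has_bochner_integral_iff)
qed

text \<open>
  Euler's Beta integral for complex parameters. With weights \<open>exp (-x)\<close>, integrating the
  convolution over \<open>u\<close> gives \<open>\<Gamma>(a) \<Gamma>(b)\<close> by Fubini; by scaling it also gives the unknown constant
  times \<open>\<Gamma>(a + b)\<close>.
\<close>
lemma truncated_power_convolution:
  assumes "Re a > 0" "Re b > 0"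
  shows "(\<integral>x. truncated_power a x * truncated_power b (u - x) \<partial>lborel) =
           Beta a b * truncated_power (a + b) u"
proof -
  define f where "f = (\<lambda>a x. truncated_power a x * of_real (exp (-x)))"
  define K where "K = (\<integral>x. truncated_power a x * truncated_power b (1 - x) \<partial>lborel)"
  have f_meas [measurable]: "f c \<in> borel_measurable borel" for c unfolding f_def by measurable
  have f_int: "integrable lborel (f c)" "integral\<^sup>L lborel (f c) = Gamma c" if "Re c > 0" for c
    using has_bochner_integral_Gamma[OF that] by (auto simp: f_def has_bochner_integral_iff)
  have shift: "(\<integral>u. g (u - t) \<partial>lborel) = integral\<^sup>L lborel g" for g :: "real \<Rightarrow> 'b::{banach, second_countable_topology}" and t
    using lborel_integral_real_affine[of 1 g "-t"] by simp
  have shift_int: "integrable lborel (\<lambda>u. f b (u - t))" for t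
    using lborel_integrable_real_affine[OF f_int(1)[OF assms(2)], of 1 "-t"] by simp
  have prod_int: "integrable (lborel \<Otimes>\<^sub>M lborel) (\<lambda>(t, u). f a t * f b (u - t))"
  proof (rule lborel_pair.Fubini_integrable)
    show "integrable lborel (\<lambda>t. \<integral>u. norm (case (t, u) of (t, u) \<Rightarrow> f a t * f b (u - t)) \<partial>lborel)"
      using f_int(1)[OF assms(1)] shift[of "\<lambda>u. norm (f b u)"] by (simp add: norm_mult)
  qed (auto intro!: AE_I2 shift_int)
  have "Gamma a * Gamma b = (\<integral>t. \<integral>u. f a t * f b (u - t) \<partial>lborel \<partial>lborel)"
    using assms by (simp add: shift f_int)
  also have "\<dots> = (\<integral>u. \<integral>t. f a t * f b (u - t) \<partial>lborel \<partial>lborel)"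
    using lborel_pair.Fubini_integral[OF prod_int] by simp
  also have "(\<lambda>u. \<integral>t. f a t * f b (u - t) \<partial>lborel) = (\<lambda>u. f (a + b) u * K)"
  proof
    fix u
    have "(\<lambda>t. f a t * f b (u - t)) =
        (\<lambda>t. of_real (exp (-u)) * (truncated_power a t * truncated_power b (u - t)))"
      by (auto simp: f_def fun_eq_iff simp flip: of_real_mult exp_add)
    thus "(\<integral>t. f a t * f b (u - t) \<partial>lborel) = f (a + b) u * K"
      by (simp add: truncated_power_convolution_scale[of a b u] K_def f_def)
  qed
  also have "integral\<^sup>L lborel \<dots> = Gamma (a + b) * K" using assms by (simp add: f_int)
  finally have "K = Beta a b"
  proof -
    have "Gamma (a + b) \<noteq> 0" using assms by (simp add: Gamma_eq_zero_iff Re_pos_not_nonpos_Ints)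
    thus "Gamma a * Gamma b = Gamma (a + b) * K \<Longrightarrow> K = Beta a b" by (simp add: Beta_def field_simps)
  qed
  thus ?thesis using truncated_power_convolution_scale[of a b u] by (simp add: K_def)
qed

lemma has_vector_derivative_truncated_power:
  assumes "x > 0"
  shows "(truncated_power a has_vector_derivative (a - 1) * truncated_power (a - 1) x) (at x)"
proof (rule has_vector_derivative_transform_within_open)
  show "((\<lambda>x. of_real x powr (a - 1)) has_vector_derivative (a - 1) * truncated_power (a - 1) x) (at x)"
    using assms
    by (intro has_vector_derivative_real_field)
       (auto intro!: derivative_eq_intros simp: truncated_power_def)
  show "open {0::real<..}" "x \<in> {0<..}" using assms by auto
qed (auto simp: truncated_power_def)

section \<open>Convergence of the double series\<close>

text \<open>
  On the lattice \<open>\<alpha> k + \<beta> l + \<gamma>\<close> the imaginary part grows at most linearly in \<open>k + l\<close>, while the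
  real part grows at least linearly, because \<open>Re \<alpha>\<close> and \<open>Re \<beta>\<close> are positive. Superexponential
  decay in the real part therefore wins over exponential growth in the imaginary part. The
  functional equation reduces an arbitrary \<open>\<gamma>\<close> to one with \<open>Re \<gamma> \<ge> 1\<close>.
\<close>
lemma rGamma_lattice_decay:
  fixes \<alpha> \<beta> \<gamma> :: complex and q :: real
  assumes "Re \<alpha> > 0" "Re \<beta> > 0" "q > 0"
  shows "\<exists>C\<ge>0. \<forall>k l. norm (rGamma (\<alpha> * of_nat k + \<beta> * of_nat l + \<gamma>)) \<le> C * q ^ (k + l)"
proof -
  define P where "P = (\<lambda>\<gamma>. \<forall>q>0. \<exists>C\<ge>0. \<forall>k l.
    norm (rGamma (\<alpha> * of_nat k + \<beta> * of_nat l + \<gamma>)) \<le> C * q ^ (k + l))"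
  have base: "P \<gamma>" if \<gamma>: "Re \<gamma> \<ge> 1" for \<gamma>
    unfolding P_def
  proof (intro allI impI)
    fix q :: real assume q: "q > 0"
    define a where "a = min (Re \<alpha>) (Re \<beta>)"
    define b where "b = max \<bar>Im \<alpha>\<bar> \<bar>Im \<beta>\<bar>"
    \<comment> \<open>Chosen so that the growth rate pi * b minus the decay rate M * a is at most ln q.\<close>
    define M where "M = max 0 ((pi * b - ln q) / a)"
    have a: "a > 0" using assms by (simp add: a_def)
    have Mq: "exp (pi * b - M * a) \<le> q"
    proof -
      have "(pi * b - ln q) / a \<le> M" by (simp add: M_def)
      hence "pi * b - M * a \<le> ln q" using a by (simp add: field_simps)
      thus ?thesis using q by (metis exp_le_cancel_iff exp_ln)
    qed
    obtain A where A: "A \<ge> 0"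
      "\<And>z. 1 \<le> Re z \<Longrightarrow> norm (rGamma z) \<le> A * exp (pi * \<bar>Im z\<bar> - M * Re z)"
      using norm_rGamma_le by blast
    show "\<exists>C\<ge>0. \<forall>k l. norm (rGamma (\<alpha> * of_nat k + \<beta> * of_nat l + \<gamma>)) \<le> C * q ^ (k + l)"
    proof (intro exI[of _ "A * exp (pi * \<bar>Im \<gamma>\<bar>)"] conjI allI)
      fix k l
      define w where "w = \<alpha> * of_nat k + \<beta> * of_nat l + \<gamma>"
      have Re: "a * real (k + l) + Re \<gamma> \<le> Re w"
        using mult_right_mono[of a "Re \<alpha>" k] mult_right_mono[of a "Re \<beta>" l]
        by (simp add: w_def a_def algebra_simps)
      have "\<bar>Im w\<bar> \<le> \<bar>Im \<alpha>\<bar> * real k + \<bar>Im \<beta>\<bar> * real l + \<bar>Im \<gamma>\<bar>"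
        using abs_triangle_ineq[of "Im \<alpha> * k + Im \<beta> * l" "Im \<gamma>"]
          abs_triangle_ineq[of "Im \<alpha> * k" "Im \<beta> * l"]
        by (simp add: w_def abs_mult)
      also have "\<dots> \<le> b * real (k + l) + \<bar>Im \<gamma>\<bar>"
        using mult_right_mono[of "\<bar>Im \<alpha>\<bar>" b k] mult_right_mono[of "\<bar>Im \<beta>\<bar>" b l]
        by (simp add: b_def algebra_simps)
      finally have Im: "\<bar>Im w\<bar> \<le> b * real (k + l) + \<bar>Im \<gamma>\<bar>" .
      have "M * (a * real (k + l)) \<le> M * Re w"
        using Re \<gamma> by (intro mult_left_mono) (auto simp: M_def)
      moreover have "pi * \<bar>Im w\<bar> \<le> pi * (b * real (k + l) + \<bar>Im \<gamma>\<bar>)"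
        by (intro mult_left_mono Im) auto
      ultimately have ex: "pi * \<bar>Im w\<bar> - M * Re w \<le> pi * \<bar>Im \<gamma>\<bar> + real (k + l) * (pi * b - M * a)"
        by (simp add: algebra_simps)
      have "Re w \<ge> 1" using Re \<gamma> a by (smt (verit) mult_nonneg_nonneg of_nat_0_le_iff)
      hence "norm (rGamma w) \<le> A * exp (pi * \<bar>Im w\<bar> - M * Re w)" by (rule A)
      also have "\<dots> \<le> A * exp (pi * \<bar>Im \<gamma>\<bar> + real (k + l) * (pi * b - M * a))"
        using ex A(1) by (intro mult_left_mono) auto
      also have "\<dots> = A * exp (pi * \<bar>Im \<gamma>\<bar>) * exp (pi * b - M * a) ^ (k + l)"
        by (simp only: exp_add exp_of_nat_mult mult.assoc)
      also have "\<dots> \<le> A * exp (pi * \<bar>Im \<gamma>\<bar>) * q ^ (k + l)"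
        using A(1) Mq by (intro mult_left_mono power_mono) auto
      finally show "norm (rGamma (\<alpha> * of_nat k + \<beta> * of_nat l + \<gamma>))
          \<le> A * exp (pi * \<bar>Im \<gamma>\<bar>) * q ^ (k + l)" by (simp add: w_def)
    qed (use A in auto)
  qed
  have step: "P \<gamma>" if "P (\<gamma> + 1)" for \<gamma>
    unfolding P_def
  proof (intro allI impI)
    fix q :: real assume q: "q > 0"
    then obtain C where C: "C \<ge> 0"
      "\<And>k l. norm (rGamma (\<alpha> * of_nat k + \<beta> * of_nat l + (\<gamma> + 1))) \<le> C * (q / 2) ^ (k + l)"
      using \<open>P (\<gamma> + 1)\<close> unfolding P_def by (metis half_gt_zero)
    \<comment> \<open>Passing from \<open>\<gamma> + 1\<close> to \<open>\<gamma>\<close> costs one linear factor, which is absorbed by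
       decay at rate q / 2 instead of q.\<close>
    define D where "D = norm \<alpha> + norm \<beta> + norm \<gamma>"
    show "\<exists>C\<ge>0. \<forall>k l. norm (rGamma (\<alpha> * of_nat k + \<beta> * of_nat l + \<gamma>)) \<le> C * q ^ (k + l)"
    proof (intro exI[of _ "D * C"] conjI allI)
      fix k l
      define w where "w = \<alpha> * of_nat k + \<beta> * of_nat l + \<gamma>"
      have pw: "real n \<le> 2 ^ (k + l)" if "n \<le> k + l" for n
        using that less_exp[of "k + l"] by (metis less_imp_le_nat of_nat_le_iff of_nat_numeral of_nat_power order.trans)
      have "norm w \<le> norm \<alpha> * real k + norm \<beta> * real l + norm \<gamma> * 1"
        using norm_triangle_ineq[of "\<alpha> * of_nat k + \<beta> * of_nat l" \<gamma>]
          norm_triangle_ineq[of "\<alpha> * of_nat k" "\<beta> * of_nat l"]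
        by (simp add: w_def norm_mult)
      also have "\<dots> \<le> norm \<alpha> * 2 ^ (k + l) + norm \<beta> * 2 ^ (k + l) + norm \<gamma> * 2 ^ (k + l)"
        by (intro add_mono mult_left_mono pw) auto
      also have "\<dots> = D * 2 ^ (k + l)" by (simp add: D_def algebra_simps)
      finally have w: "norm w \<le> D * 2 ^ (k + l)" .
      have "norm (rGamma w) = norm w * norm (rGamma (w + 1))"
        using rGamma_plus1[of w] by (metis norm_mult)
      also have "\<dots> \<le> (D * 2 ^ (k + l)) * (C * (q / 2) ^ (k + l))"
        using w C(2)[of k l] by (intro mult_mono) (auto simp: w_def add.assoc D_def)
      also have "\<dots> = D * C * q ^ (k + l)" by (simp add: power_divide)
      finally show "norm (rGamma (\<alpha> * of_nat k + \<beta> * of_nat l + \<gamma>)) \<le> D * C * q ^ (k + l)"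
        by (simp add: w_def)
    qed (use C in \<open>auto simp: D_def\<close>)
  qed
  have "P (\<gamma> + of_nat n) \<Longrightarrow> P \<gamma>" for n
  proof (induction n)
    case (Suc n)
    hence "P (\<gamma> + of_nat n + 1)" by (simp add: add_ac)
    thus ?case using step Suc.IH by blast
  qed simp
  moreover have "P (\<gamma> + of_nat (nat \<lceil>1 - Re \<gamma>\<rceil>))" by (rule base) (simp, linarith)
  ultimately have "P \<gamma>" by blast
  thus ?thesis using assms(3) by (simp add: P_def)
qed

lemma norm_pochhammer_le:
  fixes \<delta> :: complex
  shows "norm (pochhammer \<delta> n) \<le> fact n * max 1 (norm \<delta>) ^ n"
proof -
  define d where "d = max 1 (norm \<delta>)"
  have "norm (pochhammer \<delta> n) = (\<Prod>i<n. norm (\<delta> + of_nat i))"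
    by (simp add: pochhammer_prod atLeast0LessThan prod_norm)
  also have "\<dots> \<le> (\<Prod>i<n. real (Suc i) * d)"
  proof (intro prod_mono conjI)
    fix i
    have "norm (\<delta> + of_nat i) \<le> d + real i * 1"
      using norm_triangle_ineq[of \<delta> "of_nat i"] by (simp add: d_def)
    also have "\<dots> \<le> d + real i * d" by (intro add_left_mono mult_left_mono) (auto simp: d_def)
    finally show "norm (\<delta> + of_nat i) \<le> real (Suc i) * d" by (simp add: algebra_simps)
  qed simp
  also have "\<dots> = fact n * d ^ n"
    by (simp add: prod.distrib fact_prod_Suc atLeast0LessThan)
  finally show ?thesis by (simp add: d_def)
qed

definition mittag_leffler_term :: "complex \<Rightarrow> complex \<Rightarrow> complex \<Rightarrow> complex \<Rightarrow> complex \<Rightarrow> complex \<Rightarrow> nat \<times> nat \<Rightarrow> complex" where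
  "mittag_leffler_term \<alpha> \<beta> \<gamma> \<delta> x y = (\<lambda>(k, l). pochhammer \<delta> (k + l) *
     rGamma (\<alpha> * of_nat k + \<beta> * of_nat l + \<gamma>) * (x ^ k * y ^ l / (fact k * fact l)))"

text \<open>
  The double series converges absolutely, and uniformly on bounded sets of arguments: the
  Pochhammer symbol and the factorials contribute at most a geometric factor (a binomial
  coefficient is at most \<open>2 ^ (k + l)\<close>), and the decay of \<open>1 / \<Gamma>\<close> is faster than any geometric
  rate.
\<close>
lemma norm_mittag_leffler_term_le:
  fixes R :: real
  assumes "Re \<alpha> > 0" "Re \<beta> > 0"
  obtains C where "C \<ge> 0" "\<And>x y k l. norm x \<le> R \<Longrightarrow> norm y \<le> R \<Longrightarrow>
    norm (mittag_leffler_term \<alpha> \<beta> \<gamma> \<delta> x y (k, l)) \<le> C * (1 / 2) ^ (k + l)"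
proof -
  define d where "d = max 1 (norm \<delta>)"
  define r where "r = max 1 R"
  \<comment> \<open>The factor 4 pays for the binomial coefficient and for the target rate 1 / 2.\<close>
  define q where "q = 1 / (4 * d * r)"
  have pos: "d > 0" "r > 0" "q > 0" by (auto simp: d_def r_def q_def)
  obtain C where C: "C \<ge> 0"
    "\<And>k l. norm (rGamma (\<alpha> * of_nat k + \<beta> * of_nat l + \<gamma>)) \<le> C * q ^ (k + l)"
    using rGamma_lattice_decay[OF assms \<open>q > 0\<close>] by blast
  show thesis
  proof (rule that[OF C(1)])
    fix x y :: complex and k l :: nat
    assume xy: "norm x \<le> R" "norm y \<le> R"
    have fk: "fact (k + l) / (fact k * fact l) \<le> (2::real) ^ (k + l)"
    proof -
      have "fact (k + l) / (fact k * fact l) = real ((k + l) choose k)"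
        by (simp add: binomial_fact)
      also have "\<dots> \<le> real (2 ^ (k + l))" by (subst of_nat_le_iff) (rule binomial_le_pow2)
      finally show ?thesis by simp
    qed
    have "norm (mittag_leffler_term \<alpha> \<beta> \<gamma> \<delta> x y (k, l)) = norm (pochhammer \<delta> (k + l)) *
        norm (rGamma (\<alpha> * of_nat k + \<beta> * of_nat l + \<gamma>)) *
        (norm x ^ k * norm y ^ l / (fact k * fact l))"
      by (simp add: mittag_leffler_term_def norm_mult norm_divide norm_power)
    also have "\<dots> \<le> (fact (k + l) * d ^ (k + l)) * (C * q ^ (k + l)) *
        (r ^ k * r ^ l / (fact k * fact l))"
      using xy norm_pochhammer_le[of \<delta> "k + l"] C pos
      by (intro mult_mono divide_right_mono power_mono mult_nonneg_nonneg C(2)) (auto simp: d_def r_def)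
    also have "\<dots> = C * (d * q * r) ^ (k + l) * (fact (k + l) / (fact k * fact l))"
      by (simp add: power_mult_distrib power_add)
    also have "\<dots> \<le> C * (d * q * r) ^ (k + l) * 2 ^ (k + l)"
      using C(1) pos by (intro mult_left_mono fk) auto
    also have "\<dots> = C * (d * q * r * 2) ^ (k + l)" by (simp add: power_mult_distrib)
    also have "d * q * r * 2 = 1 / 2" using pos by (simp add: q_def)
    finally show "norm (mittag_leffler_term \<alpha> \<beta> \<gamma> \<delta> x y (k, l)) \<le> C * (1 / 2) ^ (k + l)" .
  qed
qed

lemma has_sum_half_powers: "((\<lambda>(k, l). (1 / 2) ^ (k + l) :: real) has_sum 4) UNIV"
proof -
  have h: "((\<lambda>k. (1 / 2) ^ k :: real) has_sum 2) UNIV"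
    using geometric_sums[of "1 / 2 :: real"] by (intro sums_nonneg_imp_has_sum) auto
  have inner: "((\<lambda>l. (1 / 2) ^ (k + l) :: real) has_sum ((1 / 2) ^ k * 2)) UNIV" for k
    using has_sum_cmult_right[OF h, of "(1 / 2) ^ k"] by (simp only: power_add)
  have outer: "((\<lambda>k. (1 / 2) ^ k * 2 :: real) has_sum (2 * 2)) UNIV"
    by (rule has_sum_cmult_left[OF h])
  have "(\<lambda>(k, l). (1 / 2) ^ (k + l) :: real) summable_on Sigma UNIV (\<lambda>_. UNIV)"
    by (rule summable_on_SigmaI[OF _ has_sum_imp_summable[OF outer]]) (simp_all only: prod.case inner, simp)
  from has_sum_SigmaI[OF _ outer this] inner show ?thesis by simp
qed

text \<open>
  The double geometric series, enumerated by the pairing function: one summable majorant for all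
  later exchanges of a limit with the double sum. Single-indexed series are what the theorems on
  termwise integration and differentiation expect.
\<close>
definition half_powers :: "nat \<Rightarrow> real" where
  "half_powers n = (case prod_decode n of (k, l) \<Rightarrow> (1 / 2) ^ (k + l))"

lemma summable_half_powers: "summable half_powers"
proof -
  have "half_powers summable_on UNIV"
    using has_sum_imp_summable[OF has_sum_half_powers] bij_prod_decode
    by (subst (asm) summable_on_reindex_bij_betw[symmetric, where g = prod_decode and A = UNIV])
       (auto simp: half_powers_def[abs_def])
  thus ?thesis by (rule summable_on_imp_summable)
qed

lemma bivariate_ML_sums:
  assumes "Re \<alpha> > 0" "Re \<beta> > 0"
  shows "(\<lambda>n. mittag_leffler_term \<alpha> \<beta> \<gamma> \<delta> x y (prod_decode n)) sums bivariate_ML \<alpha> \<beta> \<gamma> \<delta> x y"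
proof -
  let ?g = "mittag_leffler_term \<alpha> \<beta> \<gamma> \<delta> x y"
  obtain C where C: "\<And>k l. norm (?g (k, l)) \<le> C * (1 / 2) ^ (k + l)"
    using norm_mittag_leffler_term_le[OF assms, of "max (norm x) (norm y)" \<gamma> \<delta>] by (metis max.cobounded1 max.cobounded2)
  have "(\<lambda>p. norm (?g p)) summable_on UNIV"
  proof (rule summable_on_comparison_test)
    show "(\<lambda>p. C * (case p of (k, l) \<Rightarrow> (1 / 2) ^ (k + l))) summable_on UNIV"
      by (intro summable_on_cmult_right has_sum_imp_summable[OF has_sum_half_powers])
  qed (use C in auto)
  hence s: "?g summable_on UNIV" by (rule abs_summable_summable)
  then obtain S where S: "(?g has_sum S) UNIV" by (auto simp: summable_on_def)
  have "((\<lambda>n. ?g (prod_decode n)) has_sum S) UNIV"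
    using S by (subst has_sum_reindex_bij_betw[OF bij_prod_decode])
  hence 1: "(\<lambda>n. ?g (prod_decode n)) sums S" by (rule has_sum_imp_sums)
  have inner: "(\<lambda>l. ?g (k, l)) summable_on UNIV" for k
    using summable_on_SigmaD1[of "\<lambda>k l. ?g (k, l)" UNIV "\<lambda>_. UNIV" k] s by simp
  hence inner': "(\<lambda>l. ?g (k, l)) sums (\<Sum>\<^sub>\<infinity>l. ?g (k, l))" for k
    by (intro has_sum_imp_sums has_sum_infsum)
  have "((\<lambda>k. \<Sum>\<^sub>\<infinity>l. ?g (k, l)) has_sum S) UNIV"
    using has_sum_SigmaD[of ?g UNIV "\<lambda>_. UNIV" S "\<lambda>k. \<Sum>\<^sub>\<infinity>l. ?g (k, l)"] S inner by simp
  hence "(\<lambda>k. \<Sum>\<^sub>\<infinity>l. ?g (k, l)) sums S" by (rule has_sum_imp_sums)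
  hence "(\<Sum>k. \<Sum>l. ?g (k, l)) = S" using sums_unique[OF inner'] by (simp add: sums_iff)
  with 1 show ?thesis by (simp add: bivariate_ML_def mittag_leffler_term_def)
qed

section \<open>Fractional calculus of the Mittag-Leffler kernel\<close>

context
  fixes \<alpha> \<beta> \<delta> \<omega>\<^sub>1 \<omega>\<^sub>2 :: complex
begin

definition kernel_exponent :: "complex \<Rightarrow> nat \<Rightarrow> complex" where
  "kernel_exponent \<gamma> n = (case prod_decode n of (k, l) \<Rightarrow> \<alpha> * of_nat k + \<beta> * of_nat l + \<gamma>)"

definition kernel_coeff :: "nat \<Rightarrow> complex" where
  "kernel_coeff n = (case prod_decode n of (k, l) \<Rightarrow>
     pochhammer \<delta> (k + l) * (\<omega>\<^sub>1 ^ k * \<omega>\<^sub>2 ^ l / (fact k * fact l)))"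

definition kernel_term :: "complex \<Rightarrow> nat \<Rightarrow> real \<Rightarrow> complex" where
  "kernel_term \<gamma> n u =
     kernel_coeff n * rGamma (kernel_exponent \<gamma> n) * truncated_power (kernel_exponent \<gamma> n) u"

text \<open>
  The function \<open>u powr (\<gamma> - 1) * E (\<omega>\<^sub>1 * u powr \<alpha>, \<omega>\<^sub>2 * u powr \<beta>)\<close> for \<open>u > 0\<close>, extended by
  zero, as a series of truncated powers. In this form both fractional operators only shift \<open>\<gamma>\<close>.
\<close>
definition mittag_leffler_kernel :: "complex \<Rightarrow> real \<Rightarrow> complex" where
  "mittag_leffler_kernel \<gamma> u = (\<Sum>n. kernel_term \<gamma> n u)"

lemma kernel_exponent_add: "kernel_exponent (\<gamma> + \<nu>) n = kernel_exponent \<gamma> n + \<nu>"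
  by (simp add: kernel_exponent_def split: prod.split)

lemma kernel_exponent_diff: "kernel_exponent (\<gamma> - \<nu>) n = kernel_exponent \<gamma> n - \<nu>"
  using kernel_exponent_add[of "\<gamma> - \<nu>" \<nu> n] by simp

lemma kernel_term_nonpos: "u \<le> 0 \<Longrightarrow> kernel_term \<gamma> n u = 0"
  by (simp add: kernel_term_def truncated_power_def)

lemma mittag_leffler_kernel_nonpos: "u \<le> 0 \<Longrightarrow> mittag_leffler_kernel \<gamma> u = 0"
  by (simp add: mittag_leffler_kernel_def kernel_term_nonpos)

lemma kernel_term_eq_mittag_leffler_term:
  assumes "u > 0"
  shows "kernel_term \<gamma> n u = of_real u powr (\<gamma> - 1) *
    mittag_leffler_term \<alpha> \<beta> \<gamma> \<delta> (\<omega>\<^sub>1 * of_real u powr \<alpha>) (\<omega>\<^sub>2 * of_real u powr \<beta>) (prod_decode n)"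
proof -
  obtain k l where n: "prod_decode n = (k, l)" by fastforce
  have pw: "(of_real u powr a) ^ j = of_real u powr (a * of_nat j)" for a :: complex and j
    using assms exp_of_nat_mult[of j "a * Ln (of_real u)"] by (simp add: powr_def mult_ac)
  have "of_real u powr (\<alpha> * of_nat k + \<beta> * of_nat l + \<gamma> - 1) =
      (of_real u powr \<alpha>) ^ k * (of_real u powr \<beta>) ^ l * of_real u powr (\<gamma> - 1)"
    by (simp only: pw powr_add add_diff_eq[symmetric])
  thus ?thesis using assms
    by (simp add: kernel_term_def kernel_coeff_def kernel_exponent_def mittag_leffler_term_def n truncated_power_def
        power_mult_distrib)
qed

context
  assumes \<alpha>: "Re \<alpha> > 0" and \<beta>: "Re \<beta> > 0"
begin

text \<open>
  Powers of \<open>u\<close> with exponents \<open>\<alpha>\<close> and \<open>\<beta>\<close> stay bounded on \<open>(0, U]\<close>, so the only singularity, at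
  \<open>u = 0\<close>, is that of the leading power, which is common to all terms.
\<close>
lemma norm_kernel_term_le:
  obtains C where "C \<ge> 0" "\<And>n u. u \<le> U \<Longrightarrow>
    norm (kernel_term \<gamma> n u) \<le> C * half_powers n * norm (truncated_power \<gamma> u)"
proof -
  define R where "R = max (norm \<omega>\<^sub>1 * U powr Re \<alpha>) (norm \<omega>\<^sub>2 * U powr Re \<beta>)"
  obtain C where C: "C \<ge> 0" "\<And>x y k l. norm x \<le> R \<Longrightarrow> norm y \<le> R \<Longrightarrow>
      norm (mittag_leffler_term \<alpha> \<beta> \<gamma> \<delta> x y (k, l)) \<le> C * (1 / 2) ^ (k + l)"
    using norm_mittag_leffler_term_le[OF \<alpha> \<beta>] by blast
  have "norm (kernel_term \<gamma> n u) \<le> C * half_powers n * norm (truncated_power \<gamma> u)" if u: "u \<le> U" for n u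
  proof (cases "u > 0")
    case True
    obtain k l where n: "prod_decode n = (k, l)" by fastforce
    have "norm (\<omega>\<^sub>1 * of_real u powr \<alpha>) \<le> norm \<omega>\<^sub>1 * U powr Re \<alpha>"
      "norm (\<omega>\<^sub>2 * of_real u powr \<beta>) \<le> norm \<omega>\<^sub>2 * U powr Re \<beta>"
      using True u \<alpha> \<beta> by (auto simp: norm_mult norm_powr_real_powr intro!: mult_left_mono powr_mono2)
    hence "norm (mittag_leffler_term \<alpha> \<beta> \<gamma> \<delta> (\<omega>\<^sub>1 * of_real u powr \<alpha>) (\<omega>\<^sub>2 * of_real u powr \<beta>) (k, l))
        \<le> C * half_powers n" by (auto simp: half_powers_def n R_def intro!: C)
    from mult_right_mono[OF this, of "norm (truncated_power \<gamma> u)"] True show ?thesis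
      by (simp add: kernel_term_eq_mittag_leffler_term n norm_mult truncated_power_def mult_ac)
  qed (simp add: kernel_term_nonpos truncated_power_def)
  with C(1) show thesis using that by blast
qed

lemma mittag_leffler_kernel_eq_bivariate_ML:
  assumes "u > 0"
  shows "mittag_leffler_kernel \<gamma> u = of_real u powr (\<gamma> - 1) *
    bivariate_ML \<alpha> \<beta> \<gamma> \<delta> (\<omega>\<^sub>1 * of_real u powr \<alpha>) (\<omega>\<^sub>2 * of_real u powr \<beta>)"
  unfolding mittag_leffler_kernel_def kernel_term_eq_mittag_leffler_term[OF assms]
  by (rule sums_unique[OF sums_mult[OF bivariate_ML_sums[OF \<alpha> \<beta>]], symmetric])

lemma summable_norm_kernel_term: "summable (\<lambda>n. norm (kernel_term \<gamma> n u))"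
proof -
  obtain C where C: "C \<ge> 0" "\<And>n x. x \<le> u \<Longrightarrow>
      norm (kernel_term \<gamma> n x) \<le> C * half_powers n * norm (truncated_power \<gamma> x)"
    using norm_kernel_term_le by blast
  show ?thesis
  proof (rule summable_comparison_test')
    show "summable (\<lambda>n. C * half_powers n * norm (truncated_power \<gamma> u))"
      by (rule summable_mult2[OF summable_mult[OF summable_half_powers]])
    show "norm (norm (kernel_term \<gamma> n u)) \<le> C * half_powers n * norm (truncated_power \<gamma> u)"
      if "n \<ge> 0" for n using C(2)[of u n] by simp
  qed
qed

text \<open>
  The factor produced by differentiating the power is absorbed by \<open>(w - 1) / \<Gamma>(w) = 1 / \<Gamma>(w - 1)\<close>,
  an identity of entire functions.
\<close>
lemma has_vector_derivative_kernel_term: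
  assumes "x > 0"
  shows "(kernel_term \<gamma> n has_vector_derivative kernel_term (\<gamma> - 1) n x) (at x)"
proof -
  have "(kernel_exponent \<gamma> n - 1) * rGamma (kernel_exponent \<gamma> n) = rGamma (kernel_exponent \<gamma> n - 1)"
    using rGamma_plus1[of "kernel_exponent \<gamma> n - 1"] by simp
  hence eq: "kernel_coeff n * rGamma (kernel_exponent \<gamma> n) *
      ((kernel_exponent \<gamma> n - 1) * truncated_power (kernel_exponent \<gamma> n - 1) x) = kernel_term (\<gamma> - 1) n x"
    by (simp add: kernel_term_def kernel_exponent_diff mult_ac)
  have "kernel_term \<gamma> n = (\<lambda>u. kernel_coeff n * rGamma (kernel_exponent \<gamma> n) * truncated_power (kernel_exponent \<gamma> n) u)"
    by (simp add: kernel_term_def fun_eq_iff)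
  thus ?thesis
    using has_vector_derivative_mult_right[OF has_vector_derivative_truncated_power[OF assms],
        of "kernel_coeff n * rGamma (kernel_exponent \<gamma> n)" "kernel_exponent \<gamma> n"]
    by (simp only: eq)
qed

lemma has_vector_derivative_mittag_leffler_kernel:
  assumes u: "u > 0"
  shows "(mittag_leffler_kernel \<gamma> has_vector_derivative mittag_leffler_kernel (\<gamma> - 1) u) (at u)"
proof -
  \<comment> \<open>A compact neighbourhood of u that avoids the singularity at 0.\<close>
  define S where "S = {u / 2..2 * u}"
  have S: "convex S" "u \<in> interior S" "u \<in> S" "\<And>x. x \<in> S \<Longrightarrow> x > 0" using u by (auto simp: S_def)
  obtain C where C: "C \<ge> 0" "\<And>n x. x \<le> 2 * u \<Longrightarrow>
      norm (kernel_term (\<gamma> - 1) n x) \<le> C * half_powers n * norm (truncated_power (\<gamma> - 1) x)"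
    using norm_kernel_term_le by blast
  have "continuous_on S (\<lambda>x. x powr (Re \<gamma> - 2))"
    using S(4) by (intro continuous_intros) force+
  hence "bounded ((\<lambda>x. x powr (Re \<gamma> - 2)) ` S)"
    by (intro compact_imp_bounded compact_continuous_image) (auto simp: S_def)
  then obtain B where B: "\<And>x. x \<in> S \<Longrightarrow> norm (x powr (Re \<gamma> - 2)) \<le> B"
    unfolding bounded_iff by blast
  have lim: "uniform_limit S (\<lambda>n x. \<Sum>i<n. kernel_term (\<gamma> - 1) i x) (mittag_leffler_kernel (\<gamma> - 1)) sequentially"
    unfolding mittag_leffler_kernel_def[abs_def]
  proof (rule Weierstrass_m_test)
    fix n x assume x: "x \<in> S"
    have h: "half_powers n \<ge> 0" by (simp add: half_powers_def split: prod.split)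
    have "norm (kernel_term (\<gamma> - 1) n x) \<le> C * half_powers n * norm (truncated_power (\<gamma> - 1) x)"
      using x by (intro C) (auto simp: S_def)
    also have "\<dots> \<le> C * half_powers n * B"
      using B[OF x] S(4)[OF x] C(1) h by (intro mult_left_mono) (auto simp: norm_truncated_power)
    finally show "norm (kernel_term (\<gamma> - 1) n x) \<le> C * half_powers n * B" .
  qed (rule summable_mult2[OF summable_mult[OF summable_half_powers]])
  have "\<exists>g. \<forall>x\<in>S. (\<lambda>n. kernel_term \<gamma> n x) sums g x \<and>
      (g has_derivative (\<lambda>h. h *\<^sub>R mittag_leffler_kernel (\<gamma> - 1) x)) (at x within S)"
  proof (rule has_derivative_series[OF S(1) _ _ S(3)])
    show "(kernel_term \<gamma> n has_derivative (\<lambda>h. h *\<^sub>R kernel_term (\<gamma> - 1) n x)) (at x within S)"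
      if "x \<in> S" for n x
      using has_vector_derivative_kernel_term[OF S(4)[OF that]]
      unfolding has_vector_derivative_def by (rule has_derivative_at_withinI)
    show "\<forall>\<^sub>F n in sequentially. \<forall>x\<in>S. \<forall>h.
        norm ((\<Sum>i<n. h *\<^sub>R kernel_term (\<gamma> - 1) i x) - h *\<^sub>R mittag_leffler_kernel (\<gamma> - 1) x) \<le> e * norm h"
      if "e > 0" for e
      using uniform_limitD[OF lim that]
    proof eventually_elim
      case (elim n)
      show ?case
      proof (intro ballI allI)
        fix x h assume "x \<in> S"
        hence "norm ((\<Sum>i<n. kernel_term (\<gamma> - 1) i x) - mittag_leffler_kernel (\<gamma> - 1) x) \<le> e"
          using elim by (simp add: dist_norm less_imp_le)
        hence "\<bar>h\<bar> * norm ((\<Sum>i<n. kernel_term (\<gamma> - 1) i x) - mittag_leffler_kernel (\<gamma> - 1) x) \<le> \<bar>h\<bar> * e"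
          by (rule mult_left_mono) simp
        moreover have "(\<Sum>i<n. h *\<^sub>R kernel_term (\<gamma> - 1) i x) - h *\<^sub>R mittag_leffler_kernel (\<gamma> - 1) x =
            h *\<^sub>R ((\<Sum>i<n. kernel_term (\<gamma> - 1) i x) - mittag_leffler_kernel (\<gamma> - 1) x)"
          by (simp only: scaleR_sum_right scaleR_diff_right)
        ultimately show "norm ((\<Sum>i<n. h *\<^sub>R kernel_term (\<gamma> - 1) i x) - h *\<^sub>R mittag_leffler_kernel (\<gamma> - 1) x) \<le> e * norm h"
          by (simp add: mult.commute)
      qed
    qed
    show "(\<lambda>n. kernel_term \<gamma> n u) sums mittag_leffler_kernel \<gamma> u"
      unfolding mittag_leffler_kernel_def by (intro summable_sums summable_norm_cancel[OF summable_norm_kernel_term])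
  qed
  then obtain g where g: "\<And>x. x \<in> S \<Longrightarrow> (\<lambda>n. kernel_term \<gamma> n x) sums g x"
    "(g has_derivative (\<lambda>h. h *\<^sub>R mittag_leffler_kernel (\<gamma> - 1) u)) (at u within S)" using S(3) by blast
  have "(g has_vector_derivative mittag_leffler_kernel (\<gamma> - 1) u) (at u)"
    using g(2) at_within_interior[OF S(2)] by (simp only: has_vector_derivative_def)
  thus ?thesis
  proof (rule has_vector_derivative_transform_within_open)
    show "g x = mittag_leffler_kernel \<gamma> x" if "x \<in> interior S" for x
      using g(1)[of x] subsetD[OF interior_subset that] by (simp add: mittag_leffler_kernel_def sums_iff)
  qed (use S in auto)
qed

text \<open>
  Termwise integration: by the Beta integral each convolved term integrates to
  \<open>\<Gamma>(\<nu>)\<close> times the term for \<open>\<gamma> + \<nu>\<close>. All terms are dominated by multiples of the single convolution with the leading power,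
  which is integrable because \<open>Re \<gamma> > 0\<close>.
\<close>
lemma has_bochner_integral_mittag_leffler_kernel_convolution:
  assumes \<nu>: "Re \<nu> > 0" and \<gamma>: "Re \<gamma> > 0"
  shows "has_bochner_integral lborel (\<lambda>x. truncated_power \<nu> (u - x) * mittag_leffler_kernel \<gamma> x)
           (Gamma \<nu> * mittag_leffler_kernel (\<gamma> + \<nu>) u)"
proof -
  define f where "f = (\<lambda>n x. truncated_power \<nu> (u - x) * kernel_term \<gamma> n x)"
  have w: "Re (kernel_exponent \<gamma> n) > 0" for n
    using \<alpha> \<beta> \<gamma> by (auto simp: kernel_exponent_def split: prod.split intro!: add_nonneg_pos)
  have f_eq: "f n = (\<lambda>x. kernel_coeff n * rGamma (kernel_exponent \<gamma> n) *
      (truncated_power (kernel_exponent \<gamma> n) x * truncated_power \<nu> (u - x)))" for n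
    by (auto simp: f_def kernel_term_def fun_eq_iff)
  have f_int: "integrable lborel (f n)" for n
    unfolding f_eq by (intro integrable_mult_right integrable_truncated_power_convolution w \<nu>)
  have f_val: "integral\<^sup>L lborel (f n) = Gamma \<nu> * kernel_term (\<gamma> + \<nu>) n u" for n
  proof -
    have "rGamma (kernel_exponent \<gamma> n) * Gamma (kernel_exponent \<gamma> n) = 1"
      using Re_pos_not_nonpos_Ints[OF w] by (simp add: rGamma_inverse_Gamma Gamma_eq_zero_iff)
    hence "rGamma (kernel_exponent \<gamma> n) * Beta (kernel_exponent \<gamma> n) \<nu> =
        Gamma \<nu> * rGamma (kernel_exponent (\<gamma> + \<nu>) n)"
      by (simp add: Beta_altdef kernel_exponent_add flip: mult.assoc)
    thus ?thesis
      by (simp add: f_eq truncated_power_convolution[OF w \<nu>] kernel_term_def kernel_exponent_add)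
  qed
  have f_summable: "AE x in lborel. summable (\<lambda>n. norm (f n x))"
    unfolding f_def norm_mult by (intro AE_I2 summable_mult[OF summable_norm_kernel_term])
  obtain C where C: "C \<ge> 0" "\<And>n x. x \<le> u \<Longrightarrow>
      norm (kernel_term \<gamma> n x) \<le> C * half_powers n * norm (truncated_power \<gamma> x)"
    using norm_kernel_term_le by blast
  let ?g = "\<lambda>x. norm (truncated_power \<gamma> x * truncated_power \<nu> (u - x))"
  have g_int: "integrable lborel ?g"
    by (intro integrable_norm integrable_truncated_power_convolution \<nu> \<gamma>)
  have f_le: "norm (f n x) \<le> C * half_powers n * ?g x" for n x
  proof (cases "x \<le> u")
    case True
    from mult_right_mono[OF C(2)[OF this], of "norm (truncated_power \<nu> (u - x))"]
    show ?thesis by (simp add: f_def norm_mult mult_ac)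
  qed (simp add: f_def truncated_power_def)
  have "norm (\<integral>x. norm (f n x) \<partial>lborel) \<le> C * half_powers n * integral\<^sup>L lborel ?g" for n
    using integral_mono[OF integrable_norm[OF f_int] integrable_mult_right[OF g_int], of n "C * half_powers n"]
      f_le by simp
  hence f_sum: "summable (\<lambda>n. \<integral>x. norm (f n x) \<partial>lborel)"
    by (rule summable_comparison_test'[rotated]) (rule summable_mult2[OF summable_mult[OF summable_half_powers]])
  have eq: "(\<lambda>x. \<Sum>n. f n x) = (\<lambda>x. truncated_power \<nu> (u - x) * mittag_leffler_kernel \<gamma> x)"
    unfolding f_def mittag_leffler_kernel_def
    by (intro ext suminf_mult summable_norm_cancel[OF summable_norm_kernel_term])
  have "(\<Sum>n. integral\<^sup>L lborel (f n)) = Gamma \<nu> * mittag_leffler_kernel (\<gamma> + \<nu>) u"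
    unfolding f_val mittag_leffler_kernel_def
    by (intro suminf_mult summable_norm_cancel[OF summable_norm_kernel_term])
  with integrable_suminf[OF f_int f_summable f_sum] integral_suminf[OF f_int f_summable f_sum]
  show ?thesis by (simp add: eq has_bochner_integral_iff)
qed

text \<open>
  Truncation at zero on both sides cuts the convolution over the line down to the interval from
  \<open>c\<close> to \<open>s\<close> of the Riemann--Liouville integral.
\<close>
lemma RL_integral_mittag_leffler_kernel:
  assumes \<nu>: "Re \<nu> > 0" and \<gamma>: "Re \<gamma> > 0" and "s > c"
    and f: "\<And>x. x > c \<Longrightarrow> f x = mittag_leffler_kernel \<gamma> (x - c)"
  shows "RL_integrable c \<nu> f s" "RL_integral c \<nu> f s = mittag_leffler_kernel (\<gamma> + \<nu>) (s - c)"
proof -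
  let ?h = "\<lambda>x. truncated_power \<nu> (s - c - x) * mittag_leffler_kernel \<gamma> x"
  have eq: "(\<lambda>x. indicator (einterval (ereal c) (ereal s)) x *\<^sub>R (of_real (s - x) powr (\<nu> - 1) * f x)) =
      (\<lambda>x. ?h (-c + 1 * x))"
  proof
    fix x
    consider "c < x" "x < s" | "x \<le> c" | "s \<le> x" by linarith
    thus "indicator (einterval (ereal c) (ereal s)) x *\<^sub>R (of_real (s - x) powr (\<nu> - 1) * f x) =
        ?h (-c + 1 * x)"
    proof cases
      case 1
      thus ?thesis by (simp add: f truncated_power_def)
    next
      case 2
      hence "mittag_leffler_kernel \<gamma> (-c + 1 * x) = 0" by (intro mittag_leffler_kernel_nonpos) simp
      with 2 show ?thesis by simp
    qed (simp add: truncated_power_def)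
  qed
  note h = has_bochner_integral_mittag_leffler_kernel_convolution[OF \<nu> \<gamma>, of "s - c"]
  have "integrable lborel (\<lambda>x. ?h (-c + 1 * x))"
    by (rule lborel_integrable_real_affine) (use h in \<open>auto simp: has_bochner_integral_iff\<close>)
  thus "RL_integrable c \<nu> f s"
    using \<open>s > c\<close> unfolding RL_integrable_def interval_lebesgue_integrable_def set_integrable_def eq by simp
  have "(\<integral>x. ?h (-c + 1 * x) \<partial>lborel) = Gamma \<nu> * mittag_leffler_kernel (\<gamma> + \<nu>) (s - c)"
    using h lborel_integral_real_affine[of 1 ?h "-c"] by (simp add: has_bochner_integral_iff)
  moreover have "Gamma \<nu> \<noteq> 0" using \<nu> by (simp add: Gamma_eq_zero_iff Re_pos_not_nonpos_Ints)
  ultimately show "RL_integral c \<nu> f s = mittag_leffler_kernel (\<gamma> + \<nu>) (s - c)"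
    using \<open>s > c\<close>
    unfolding RL_integral_def interval_lebesgue_integral_def set_lebesgue_integral_def eq by simp
qed

text \<open>
  The formula for each derivative is proved on the whole half line \<open>s > c\<close>, since the next
  derivative depends on the values in a neighbourhood.
\<close>
lemma nth_deriv_mittag_leffler_kernel:
  assumes "\<And>s. s > c \<Longrightarrow> g s = mittag_leffler_kernel a (s - c)" and "s > c"
  shows "(nth_deriv k g has_vector_derivative mittag_leffler_kernel (a - of_nat (Suc k)) (s - c)) (at s)"
    and "nth_deriv k g s = mittag_leffler_kernel (a - of_nat k) (s - c)"
proof -
  have deriv: "(h has_vector_derivative mittag_leffler_kernel (b - 1) (s - c)) (at s)"
    if "\<And>s. s > c \<Longrightarrow> h s = mittag_leffler_kernel b (s - c)" "s > c" for h b s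
  proof (rule has_vector_derivative_transform_within_open)
    show "((\<lambda>s. mittag_leffler_kernel b (s - c)) has_vector_derivative mittag_leffler_kernel (b - 1) (s - c)) (at s)"
      using vector_diff_chain_at[of "\<lambda>s. s - c" 1 s "mittag_leffler_kernel b" "mittag_leffler_kernel (b - 1) (s - c)"]
        has_vector_derivative_mittag_leffler_kernel[of "s - c" b] \<open>s > c\<close>
      by (simp add: o_def has_vector_derivative_diff_const)
    show "open {c<..}" "s \<in> {c<..}" using that by auto
  qed (use that in auto)
  have val: "nth_deriv k g s = mittag_leffler_kernel (a - of_nat k) (s - c)" if "s > c" for s k
    using that
  proof (induction k arbitrary: s)
    case 0
    thus ?case using assms(1) by (simp add: nth_deriv_def)
  next
    case (Suc k)
    have "nth_deriv (Suc k) g s = vector_derivative (nth_deriv k g) (at s)"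
      by (simp add: nth_deriv_def)
    also have "\<dots> = mittag_leffler_kernel (a - of_nat k - 1) (s - c)"
      by (rule vector_derivative_at) (rule deriv[OF Suc.IH Suc.prems])
    finally show ?case by (simp add: algebra_simps)
  qed
  show "nth_deriv k g s = mittag_leffler_kernel (a - of_nat k) (s - c)" by (rule val) fact
  show "(nth_deriv k g has_vector_derivative mittag_leffler_kernel (a - of_nat (Suc k)) (s - c)) (at s)"
    using deriv[OF val assms(2), of k] by (simp add: algebra_simps)
qed

text \<open>
  A fractional derivative is a fractional integral of order \<open>m - \<mu>\<close> followed by \<open>m\<close> derivatives,
  which shift the parameter by \<open>m - \<mu>\<close> and by \<open>-m\<close>.
\<close>
lemma RL_D_mittag_leffler_kernel:
  assumes \<gamma>: "Re \<gamma> > 0" and "t > c"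
    and f: "\<And>x. x > c \<Longrightarrow> f x = mittag_leffler_kernel \<gamma> (x - c)"
  shows "RL_D_exists c \<mu> f t" "RL_D c \<mu> f t = mittag_leffler_kernel (\<gamma> - \<mu>) (t - c)"
proof -
  have "RL_D_exists c \<mu> f t \<and> RL_D c \<mu> f t = mittag_leffler_kernel (\<gamma> - \<mu>) (t - c)"
  proof (cases "Re \<mu> < 0")
    case True
    thus ?thesis using RL_integral_mittag_leffler_kernel[OF _ \<gamma> \<open>t > c\<close> f, of "-\<mu>"]
      by (simp add: RL_D_exists_def RL_D_def)
  next
    case False
    define m where "m = RL_order \<mu>"
    define \<nu> where "\<nu> = of_nat m - \<mu>"
    have \<nu>: "Re \<nu> > 0" using False unfolding \<nu>_def m_def RL_order_def by simp
    have I: "RL_integrable c \<nu> f s" "RL_integral c \<nu> f s = mittag_leffler_kernel (\<gamma> + \<nu>) (s - c)"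
      if "s > c" for s
      using RL_integral_mittag_leffler_kernel[OF \<nu> \<gamma> that f] by auto
    note D = nth_deriv_mittag_leffler_kernel[of c "RL_integral c \<nu> f", OF I(2)]
    have ev: "\<forall>\<^sub>F s in nhds t. s > c" using \<open>t > c\<close> by (rule eventually_nhds_in_open[of "{c<..}", simplified])
    have "RL_D_exists c \<mu> f t"
      unfolding RL_D_exists_def m_def[symmetric] \<nu>_def[symmetric]
      using False ev I(1) D(1) by (auto elim!: eventually_mono intro: differentiableI_vector)
    moreover have "RL_D c \<mu> f t = mittag_leffler_kernel (\<gamma> - \<mu>) (t - c)"
      using False D(2)[OF _ \<open>t > c\<close>, of m]
      by (simp add: RL_D_def m_def[symmetric] \<nu>_def[symmetric]) (simp add: \<nu>_def)
    ultimately show ?thesis ..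
  qed
  thus "RL_D_exists c \<mu> f t" "RL_D c \<mu> f t = mittag_leffler_kernel (\<gamma> - \<mu>) (t - c)" by auto
qed

end
end

theorem theorem2p11:
  fixes \<alpha> \<beta> \<gamma> \<delta> \<omega>\<^sub>1 \<omega>\<^sub>2 \<mu> :: complex and c t :: real
  assumes "Re \<alpha> > 0" and "Re \<beta> > 0" and "Re \<gamma> > 0" and "t > c"
  defines "f \<equiv> (\<lambda>s::real. of_real (s - c) powr (\<gamma> - 1) *
      bivariate_ML \<alpha> \<beta> \<gamma> \<delta> (\<omega>\<^sub>1 * of_real (s - c) powr \<alpha>) (\<omega>\<^sub>2 * of_real (s - c) powr \<beta>))"
  shows "RL_D_exists c \<mu> f t \<and>
    RL_D c \<mu> f t =
      of_real (t - c) powr (\<gamma> - \<mu> - 1) *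
      bivariate_ML \<alpha> \<beta> (\<gamma> - \<mu>) \<delta> (\<omega>\<^sub>1 * of_real (t - c) powr \<alpha>) (\<omega>\<^sub>2 * of_real (t - c) powr \<beta>)"
proof -
  note kernel = mittag_leffler_kernel_eq_bivariate_ML[OF assms(1,2)]
  have "f x = mittag_leffler_kernel \<alpha> \<beta> \<delta> \<omega>\<^sub>1 \<omega>\<^sub>2 \<gamma> (x - c)" if "x > c" for x
    using that by (simp add: f_def kernel del: of_real_diff)
  from RL_D_mittag_leffler_kernel[OF assms(1-4) this] show ?thesis
    using assms(4) by (simp add: kernel del: of_real_diff)
qed

end
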